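(* Let $Q$ be a *-quantale. The following conditions are equivalent: (1) $Q$ is a *-simple *-quantale; (2) $Q$ is a strictly faithful *-factor; (3) $Q$ has a subset which is both *-separating and cyclic.
   Context: A quantale is a complete lattice $Q$ (top $1$, bottom $0$) with an associative multiplication satisfying $a(\bigvee a_i)=\bigvee(aa_i)$ and $(\bigvee a_i)a=\bigvee(a_ia)$ (no unit is assumed). A quantale morphism preserves arbitrary joins and multiplication. A congruence on $Q$ is an equivalence relation compatible with multiplication on both sides and with arbitrary joins. A *-quantale is a quantale with a unary operation $^*$ satisfying $a^{**}=a$, $(ab)^*=b^*a^*$, $(\bigvee a_i)^*=\bigvee a_i^*$. A *-morphism is a quantale morphism of *-quantales preserving $^*$. A *-congruence is a quantale congruence $\sim$ such that $a\sim b$ implies $a^*\sim b^*$. An element $a$ is hermitian if $a^*=a$. An element $a\in Q$ is right-sided if $a1\le a$, left-sided if $1a\le a$, two-sided if both; $\mathcal{R}(Q)$, $\mathcal{L}(Q)$, $\mathcal{T}(Q)$ are the corresponding sets, and $\mathcal{H}\mathcal{T}(Q)$ is the set of hermitian two-sided elements. $Q$ is *-simple if $1\cdot 1\neq 0$ and every quotient (surjective) *-morphism from $Q$ is either a *-isomorphism or a constant *-morphism onto a trivial (one-element) *-quantale; in other words, there are exactly two *-congruences on $Q$. $Q$ is a *-factor if $\mathcal{H}\mathcal{T}(Q)=\{0,1\}$ and $0\ne1$. $Q$ is strictly faithful if for all $a,b\in Q$: whenever $lar=lbr$ for all $l\in\mathcal{L}(Q)$ and all $r\in\mathcal{R}(Q)$,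 then $a=b$. Residuations: $b\to c=\bigvee\{a\mid ab\le c\}$ and $c\leftarrow a=\bigvee\{b\mid ab\le c\}$. One has $(b\to c)\leftarrow a=b\to(c\leftarrow a)$, written $b\to c\leftarrow a$. A nonempty set $P\subseteq Q$ with $1\notin P$ is cyclic if $\{a\to p\leftarrow b\mid a,b\in Q\}=P\cup\{1\}$ for every $p\in P$. A set $P\subseteq Q$ is separating if for all $a,b\in Q$ with $a\not\geq b$ there is $p\in P$ with $a\le p$ and $b\not\le p$. A set $P$ is *-separating if $P\cup P^*$ is separating, where $P^*=\{p^*\mid p\in P\}$. *)

theory Defs
  imports Main
begin

text \<open>
  Quantales are modelled as types: the top element, written 1 in the literature on
  quantales, is \<^term>\<open>top\<close>, the bottom element, written 0, is \<^term>\<open>bot\<close>, and joins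
  are given by \<^term>\<open>Sup\<close>. The multiplication has no unit. Notions that are properties of
  the whole quantale take a type argument of type \<^typ>\<open>'a itself\<close>.
\<close>

class quantale = complete_lattice + semigroup_mult +
  assumes mult_Sup: "a * Sup A = (SUP x\<in>A. a * x)"
    and Sup_mult: "Sup A * a = (SUP x\<in>A. x * a)"

class star_quantale = quantale +
  fixes star :: "'a \<Rightarrow> 'a"  ("_\<^sup>\<star>" [1000] 1000)
  assumes star_star: "(a\<^sup>\<star>)\<^sup>\<star> = a"
    and star_mult: "(a * b)\<^sup>\<star> = b\<^sup>\<star> * a\<^sup>\<star>"
    and star_Sup: "(Sup A)\<^sup>\<star> = (SUP x\<in>A. x\<^sup>\<star>)"

text \<open>
  Compatibility with joins: a family of pairs (a i, b i) related by R is given by the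
  set S of its members, and the joins of the two families are those of the projections of S.
\<close>

definition quantale_congruence :: "('a::quantale \<times> 'a) set \<Rightarrow> bool" where
  "quantale_congruence R \<longleftrightarrow>
     equiv UNIV R \<and>
     (\<forall>a b c. (a, b) \<in> R \<longrightarrow> (c * a, c * b) \<in> R \<and> (a * c, b * c) \<in> R) \<and>
     (\<forall>S \<subseteq> R. (Sup (fst ` S), Sup (snd ` S)) \<in> R)"

definition star_congruence :: "('a::star_quantale \<times> 'a) set \<Rightarrow> bool" where
  "star_congruence R \<longleftrightarrow>
     quantale_congruence R \<and> (\<forall>a b. (a, b) \<in> R \<longrightarrow> (a\<^sup>\<star>, b\<^sup>\<star>) \<in> R)"

text \<open>
  Quotient *-morphisms correspond to *-congruences (their kernels), so simplicity is
  expressed by there being exactly two of the latter; this avoids quantifying over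
  the quantales that are codomains of morphisms.
\<close>

definition star_simple :: "'a::star_quantale itself \<Rightarrow> bool" where
  "star_simple _ \<longleftrightarrow>
     (top::'a) * top \<noteq> bot \<and> card {R :: ('a \<times> 'a) set. star_congruence R} = 2"

definition right_sided :: "'a::quantale set" where
  "right_sided = {a. a * top \<le> a}"

definition left_sided :: "'a::quantale set" where
  "left_sided = {a. top * a \<le> a}"

definition two_sided :: "'a::quantale set" where
  "two_sided = right_sided \<inter> left_sided"

definition hermitian :: "'a::star_quantale \<Rightarrow> bool" where
  "hermitian a \<longleftrightarrow> a\<^sup>\<star> = a"

definition hermitian_two_sided :: "'a::star_quantale set" where
  "hermitian_two_sided = {a \<in> two_sided. hermitian a}"

definition star_factor :: "'a::star_quantale itself \<Rightarrow> bool" where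
  "star_factor _ \<longleftrightarrow>
     (hermitian_two_sided :: 'a set) = {bot, top} \<and> (bot::'a) \<noteq> top"

definition strictly_faithful :: "'a::quantale itself \<Rightarrow> bool" where
  "strictly_faithful _ \<longleftrightarrow>
     (\<forall>a b :: 'a.
        (\<forall>l \<in> left_sided. \<forall>r \<in> right_sided. l * a * r = l * b * r) \<longrightarrow> a = b)"

definition rres :: "'a::quantale \<Rightarrow> 'a \<Rightarrow> 'a"  (infixr "\<rightarrow>\<^sub>q" 60) where
  "b \<rightarrow>\<^sub>q c = Sup {a. a * b \<le> c}"

definition lres :: "'a::quantale \<Rightarrow> 'a \<Rightarrow> 'a"  (infixl "\<leftarrow>\<^sub>q" 60) where
  "c \<leftarrow>\<^sub>q a = Sup {b. a * b \<le> c}"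

definition cyclic :: "'a::quantale set \<Rightarrow> bool" where
  "cyclic P \<longleftrightarrow>
     P \<noteq> {} \<and> top \<notin> P \<and>
     (\<forall>p \<in> P. {(a \<rightarrow>\<^sub>q p) \<leftarrow>\<^sub>q b | a b. True} = P \<union> {top})"

definition separating :: "'a::quantale set \<Rightarrow> bool" where
  "separating P \<longleftrightarrow> (\<forall>a b. \<not> a \<ge> b \<longrightarrow> (\<exists>p \<in> P. a \<le> p \<and> \<not> b \<le> p))"

definition star_separating :: "'a::star_quantale set \<Rightarrow> bool" where
  "star_separating P \<longleftrightarrow> separating (P \<union> star ` P)"

end

theory Submission imports Defs begin

unbundle lattice_syntax

text \<open>
  The proof runs through the cycle simple \<open>\<Longrightarrow>\<close> strictly faithful factor \<open>\<Longrightarrow>\<close> cyclic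
  *-separating set \<open>\<Longrightarrow>\<close> simple.

  A *-simple quantale has no room for the two evident kinds of *-congruences. Every hermitian
  two-sided \<open>h\<close> gives the quotient \<open>a \<mapsto> h \<squnion> a\<close>, which forces \<open>h \<in> {\<bottom>, \<top>}\<close>; and having the
  same values \<open>l * a * r\<close> for all left-sided \<open>l\<close> and right-sided \<open>r\<close> is a *-congruence, which
  must therefore be equality.

  In a strictly faithful *-factor the values \<open>l * a * r\<close> are two-sided, so two elements can be told
  apart by two-sided ones, and of these there are hardly any: \<open>u \<squnion> u\<^sup>\<star>\<close> and \<open>u \<sqinter> u\<^sup>\<star>\<close> are
  hermitian, so a proper two-sided element \<open>u\<close> (one different from \<open>\<bottom>\<close> and \<open>\<top>\<close>) and \<open>u\<^sup>\<star>\<close> are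
  complements, and it turns out (\<open>proper_cases\<close>) that \<open>\<bottom>, u, u\<^sup>\<star>, \<top>\<close> exhaust the two-sided
  elements. Put \<open>\<pi> = u\<close> if such a \<open>u\<close> exists and \<open>\<pi> = \<bottom>\<close> otherwise. Then \<open>\<pi>\<close> and \<open>\<pi>\<^sup>\<star>\<close> together
  separate two-sided elements, and \<open>\<pi>\<close> behaves like a prime ideal, which makes the set of all
  residuals \<open>a \<rightarrow>\<^sub>q \<pi> \<leftarrow>\<^sub>q b\<close> other than \<open>\<top>\<close> both *-separating and cyclic.

  Conversely a cyclic set \<open>P\<close> contains its own meet \<open>\<pi>\<close>: for each \<open>p \<in> P\<close> it is the residual
  \<open>\<top> \<rightarrow>\<^sub>q p \<leftarrow>\<^sub>q \<top>\<close>. If \<open>P\<close> is *-separating then \<open>\<pi> \<sqinter> \<pi>\<^sup>\<star> = \<bottom>\<close>. When a *-congruence relates two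
  distinct elements, it also relates two elements of which only one lies below some member of \<open>P\<close>.
  By cyclicity that member can be taken to be \<open>\<pi>\<close>, and separation then makes \<open>\<pi>\<close> congruent to
  \<open>\<top>\<close>. Hence \<open>\<pi> * \<pi>\<^sup>\<star> = \<bottom>\<close> is congruent to \<open>\<top> * \<top> = \<top>\<close>, and everything is identified.
\<close>

section \<open>Order and multiplication\<close>

lemma mult_sup: "(a::'a::quantale) * (b \<squnion> c) = a * b \<squnion> a * c"
  using mult_Sup[of a "{b, c}"] by simp

lemma sup_mult: "((b::'a::quantale) \<squnion> c) * a = b * a \<squnion> c * a"
  using Sup_mult[of "{b, c}" a] by simp

lemma mult_bot [simp]: "(a::'a::quantale) * \<bottom> = \<bottom>"
  using mult_Sup[of a "{}"] by simp

lemma bot_mult [simp]: "\<bottom> * (a::'a::quantale) = \<bottom>"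
  using Sup_mult[of "{}" a] by simp

lemma quantale_mult_mono: "(a::'a::quantale) \<le> b \<Longrightarrow> c \<le> d \<Longrightarrow> a * c \<le> b * d"
  by (metis le_iff_sup mult_sup order_trans sup_ge1 sup_mult)

lemma star_sup: "((a::'a::star_quantale) \<squnion> b)\<^sup>\<star> = a\<^sup>\<star> \<squnion> b\<^sup>\<star>"
  using star_Sup[of "{a, b}"] by simp

lemma star_mono: "(a::'a::star_quantale) \<le> b \<Longrightarrow> a\<^sup>\<star> \<le> b\<^sup>\<star>"
  by (metis star_sup sup.absorb_iff2)

lemma star_le_iff: "(a::'a::star_quantale)\<^sup>\<star> \<le> b \<longleftrightarrow> a \<le> b\<^sup>\<star>"
  by (metis star_mono star_star)

lemma star_bot [simp]: "(\<bottom>::'a::star_quantale)\<^sup>\<star> = \<bottom>"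
  by (metis bot.extremum star_le_iff le_bot)

lemma star_top [simp]: "(\<top>::'a::star_quantale)\<^sup>\<star> = \<top>"
  by (metis star_le_iff top_greatest top_le)

lemma star_inf: "((a::'a::star_quantale) \<sqinter> b)\<^sup>\<star> = a\<^sup>\<star> \<sqinter> b\<^sup>\<star>"
proof (rule antisym)
  show "(a \<sqinter> b)\<^sup>\<star> \<le> a\<^sup>\<star> \<sqinter> b\<^sup>\<star>" by (simp add: star_mono)
  have "(a\<^sup>\<star> \<sqinter> b\<^sup>\<star>)\<^sup>\<star> \<le> a \<sqinter> b" by (simp add: star_le_iff)
  then show "a\<^sup>\<star> \<sqinter> b\<^sup>\<star> \<le> (a \<sqinter> b)\<^sup>\<star>" by (simp only: star_le_iff)
qed

lemma mult_mult_le_top: "(a::'a::quantale) * x * b \<le> \<top> * x * \<top>"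
  by (intro quantale_mult_mono) auto

lemma left_right_sided_mult_two_sided:
  fixes l :: "'a::quantale"
  assumes "l \<in> left_sided" "r \<in> right_sided"
  shows "l * a * r \<in> two_sided"
proof -
  have "\<top> * l * (a * r) \<le> l * (a * r)" "(l * a) * (r * \<top>) \<le> (l * a) * r"
    using assms by (auto intro!: quantale_mult_mono simp: left_sided_def right_sided_def)
  then show ?thesis
    by (simp add: two_sided_def left_sided_def right_sided_def mult.assoc)
qed

lemma top_left_sided: "\<top> \<in> left_sided" and top_right_sided: "\<top> \<in> right_sided"
  by (auto simp: left_sided_def right_sided_def)

lemmas top_mult_top_two_sided =
  left_right_sided_mult_two_sided[OF top_left_sided top_right_sided]

lemma two_sidedD:
  fixes u :: "'a::quantale"
  assumes "u \<in> two_sided"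
  shows "u * a \<le> u" "a * u \<le> u" "a * u * b \<le> u"
proof -
  have *: "u * \<top> \<le> u" "\<top> * u \<le> u"
    using assms by (auto simp: two_sided_def left_sided_def right_sided_def)
  show 1: "u * a \<le> u" for a using quantale_mult_mono[of u u a \<top>] *(1) by (simp add: order_trans)
  show 2: "a * u \<le> u" using quantale_mult_mono[of a \<top> u u] *(2) by (simp add: order_trans)
  show "a * u * b \<le> u" using 1[of b] quantale_mult_mono[OF 2, of b b] by (simp add: order_trans)
qed

lemma two_sided_star: "(u::'a::star_quantale) \<in> two_sided \<Longrightarrow> u\<^sup>\<star> \<in> two_sided"
  using star_mono[of "u * \<top>" u] star_mono[of "\<top> * u" u]
  by (auto simp: two_sided_def left_sided_def right_sided_def star_mult)

lemma two_sided_sup: "(u::'a::quantale) \<in> two_sided \<Longrightarrow> v \<in> two_sided \<Longrightarrow> u \<squnion> v \<in> two_sided"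
  by (auto simp: two_sided_def left_sided_def right_sided_def sup_mult mult_sup
        intro: le_supI1 le_supI2)

lemma two_sided_inf: "(u::'a::quantale) \<in> two_sided \<Longrightarrow> v \<in> two_sided \<Longrightarrow> u \<sqinter> v \<in> two_sided"
  using two_sidedD
  by (auto simp: two_sided_def left_sided_def right_sided_def
        intro: order_trans[OF quantale_mult_mono[OF inf_le1 order_refl]]
               order_trans[OF quantale_mult_mono[OF inf_le2 order_refl]]
               order_trans[OF quantale_mult_mono[OF order_refl inf_le1]]
               order_trans[OF quantale_mult_mono[OF order_refl inf_le2]])

lemma two_sided_mult: "(u::'a::quantale) \<in> two_sided \<Longrightarrow> v \<in> two_sided \<Longrightarrow> u * v \<in> two_sided"
  by (metis (no_types, lifting) IntD1 IntD2 left_sided_def mem_Collect_eq mult.assoc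
      quantale_mult_mono order_refl right_sided_def two_sided_def IntI)

lemma two_sided_mult_le_inf: "(u::'a::quantale) \<in> two_sided \<Longrightarrow> v \<in> two_sided \<Longrightarrow> u * v \<le> u \<sqinter> v"
  by (simp add: two_sidedD)

lemma le_residual_iff:
  fixes p :: "'a::quantale"
  shows "x \<le> (a \<rightarrow>\<^sub>q p) \<leftarrow>\<^sub>q b \<longleftrightarrow> b * x * a \<le> p"
proof -
  have r: "y \<le> (a \<rightarrow>\<^sub>q p) \<longleftrightarrow> y * a \<le> p" for y
  proof
    assume "y \<le> (a \<rightarrow>\<^sub>q p)"
    then have "y * a \<le> (a \<rightarrow>\<^sub>q p) * a" by (rule quantale_mult_mono) simp
    also have "\<dots> \<le> p" unfolding rres_def Sup_mult by (auto intro: SUP_least)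
    finally show "y * a \<le> p" .
  qed (auto simp: rres_def intro: Sup_upper)
  have l: "y \<le> (q \<leftarrow>\<^sub>q b) \<longleftrightarrow> b * y \<le> q" for y q
  proof
    assume "y \<le> (q \<leftarrow>\<^sub>q b)"
    then have "b * y \<le> b * (q \<leftarrow>\<^sub>q b)" by (intro quantale_mult_mono) simp_all
    also have "\<dots> \<le> q" unfolding lres_def mult_Sup by (auto intro: SUP_least)
    finally show "b * y \<le> q" .
  qed (auto simp: lres_def intro: Sup_upper)
  show ?thesis by (simp add: l r)
qed

lemma eq_residual_iff:
  fixes p :: "'a::quantale"
  shows "q = (a \<rightarrow>\<^sub>q p) \<leftarrow>\<^sub>q b \<longleftrightarrow> (\<forall>x. x \<le> q \<longleftrightarrow> b * x * a \<le> p)"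
  using le_residual_iff by (metis order_antisym order_refl)

section \<open>Congruences and simplicity\<close>

lemma star_congruenceD:
  fixes R :: "('a::star_quantale \<times> 'a) set"
  assumes "star_congruence R"
  shows "(a, a) \<in> R"
    and "(a, b) \<in> R \<Longrightarrow> (b, a) \<in> R"
    and "(a, b) \<in> R \<Longrightarrow> (b, c) \<in> R \<Longrightarrow> (a, c) \<in> R"
    and "(a, b) \<in> R \<Longrightarrow> (c * a * d, c * b * d) \<in> R"
    and "(a, b) \<in> R \<Longrightarrow> (c, d) \<in> R \<Longrightarrow> (a * c, b * d) \<in> R"
    and "(a, b) \<in> R \<Longrightarrow> (a \<squnion> c, b \<squnion> c) \<in> R"
    and "(a, b) \<in> R \<Longrightarrow> (a\<^sup>\<star>, b\<^sup>\<star>) \<in> R"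
proof -
  have eq: "equiv UNIV R"
    and m: "\<And>a b c. (a, b) \<in> R \<Longrightarrow> (c * a, c * b) \<in> R \<and> (a * c, b * c) \<in> R"
    and S: "\<And>S. S \<subseteq> R \<Longrightarrow> (Sup (fst ` S), Sup (snd ` S)) \<in> R"
    and st: "\<And>a b. (a, b) \<in> R \<Longrightarrow> (a\<^sup>\<star>, b\<^sup>\<star>) \<in> R"
    using assms unfolding star_congruence_def quantale_congruence_def by blast+
  show r: "(a, a) \<in> R" for a using eq by (auto simp: equiv_def refl_on_def)
  show "(a, b) \<in> R \<Longrightarrow> (b, a) \<in> R" using eq by (auto simp: equiv_def dest: symD)
  show t: "(a, b) \<in> R \<Longrightarrow> (b, c) \<in> R \<Longrightarrow> (a, c) \<in> R" for a b c
    using eq unfolding equiv_def by (blast dest: transD)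
  show "(a, b) \<in> R \<Longrightarrow> (c * a * d, c * b * d) \<in> R" using m by blast
  show "(a, b) \<in> R \<Longrightarrow> (c, d) \<in> R \<Longrightarrow> (a * c, b * d) \<in> R" using m t by blast
  show "(a, b) \<in> R \<Longrightarrow> (a \<squnion> c, b \<squnion> c) \<in> R"
    using S[of "{(a, b), (c, c)}"] r by simp
  show "(a, b) \<in> R \<Longrightarrow> (a\<^sup>\<star>, b\<^sup>\<star>) \<in> R" by (rule st)
qed

lemma star_congruence_Id: "star_congruence (Id :: ('a::star_quantale \<times> 'a) set)"
proof -
  have "fst ` S = snd ` S" if "S \<subseteq> Id" for S :: "('a \<times> 'a) set"
    using that by (intro image_cong) auto
  then show ?thesis
    by (auto simp: star_congruence_def quantale_congruence_def equiv_def refl_on_def sym_def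
          trans_def)
qed

lemma star_congruence_UNIV: "star_congruence (UNIV :: ('a::star_quantale \<times> 'a) set)"
  by (auto simp: star_congruence_def quantale_congruence_def equiv_def refl_on_def sym_def
        trans_def)

lemma star_simple_iff:
  "star_simple TYPE('a::star_quantale) \<longleftrightarrow>
     (\<top>::'a) * \<top> \<noteq> \<bottom> \<and> (\<forall>R :: ('a \<times> 'a) set. star_congruence R \<longrightarrow> R = Id \<or> R = UNIV)"
proof (cases "(\<top>::'a) * \<top> = \<bottom>")
  case False
  let ?C = "{R :: ('a \<times> 'a) set. star_congruence R}"
  have "(\<bottom>::'a) \<noteq> \<top>" using False by (metis mult_bot)
  then have ne: "(Id :: ('a \<times> 'a) set) \<noteq> UNIV" by (metis UNIV_I pair_in_Id_conv)
  have sub: "{Id, UNIV} \<subseteq> ?C" using star_congruence_Id star_congruence_UNIV by blast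
  have "card ?C = 2 \<longleftrightarrow> ?C = {Id, UNIV}"
  proof
    assume c: "card ?C = 2"
    then have "finite ?C" using card.infinite by fastforce
    then have "{Id, UNIV} = ?C" using c ne by (intro card_subset_eq sub) simp_all
    then show "?C = {Id, UNIV}" by simp
  next
    assume "?C = {Id, UNIV}"
    then show "card ?C = 2" using ne by simp
  qed
  also have "\<dots> \<longleftrightarrow> (\<forall>R :: ('a \<times> 'a) set. star_congruence R \<longrightarrow> R = Id \<or> R = UNIV)"
    using sub by blast
  finally show ?thesis using False by (simp add: star_simple_def)
qed (simp add: star_simple_def)

text \<open>
  A multiplication sends a hermitian two-sided \<open>h\<close> below \<open>h\<close>, so collapsing everything below \<open>h\<close>
  to \<open>\<bottom>\<close> is compatible with it.
\<close>

lemma star_congruence_sup_hermitian: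
  fixes h :: "'a::star_quantale"
  assumes "h \<in> hermitian_two_sided"
  shows "star_congruence {(a, b). h \<squnion> a = h \<squnion> b}"
proof -
  have h: "h \<in> two_sided" "h\<^sup>\<star> = h"
    using assms by (auto simp: hermitian_two_sided_def hermitian_def)
  have l: "h \<squnion> c * a = h \<squnion> c * (h \<squnion> a)" for a c
    using two_sidedD(2)[OF h(1), of c]
    by (simp add: mult_sup sup.absorb1 flip: sup_assoc)
  have r: "h \<squnion> a * c = h \<squnion> (h \<squnion> a) * c" for a c
    using two_sidedD(1)[OF h(1), of c]
    by (simp add: sup_mult sup.absorb1 flip: sup_assoc)
  have s: "h \<squnion> a\<^sup>\<star> = (h \<squnion> a)\<^sup>\<star>" for a
    by (simp add: star_sup h)
  have le: "Sup (f ` S) \<le> h \<squnion> Sup (g ` S)"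
    if "\<And>z. z \<in> S \<Longrightarrow> h \<squnion> f z = h \<squnion> g z" for S and f g :: "'a \<times> 'a \<Rightarrow> 'a"
  proof (rule SUP_least)
    fix z assume z: "z \<in> S"
    have "f z \<le> h \<squnion> g z" using that[OF z] by (metis sup.cobounded2)
    also have "\<dots> \<le> h \<squnion> Sup (g ` S)" using z by (intro sup_mono SUP_upper) simp_all
    finally show "f z \<le> h \<squnion> Sup (g ` S)" .
  qed
  have S: "h \<squnion> Sup (fst ` S) = h \<squnion> Sup (snd ` S)" if "S \<subseteq> {(a, b). h \<squnion> a = h \<squnion> b}" for S
  proof -
    have eq: "h \<squnion> fst z = h \<squnion> snd z" if "z \<in> S" for z
      using \<open>S \<subseteq> _\<close> that by auto
    show ?thesis
      using le[OF eq] le[OF eq[symmetric]] by (intro antisym) auto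
  qed
  have m: "h \<squnion> c * a = h \<squnion> c * b \<and> h \<squnion> a * c = h \<squnion> b * c \<and> h \<squnion> a\<^sup>\<star> = h \<squnion> b\<^sup>\<star>"
    if "h \<squnion> a = h \<squnion> b" for a b c
    using l[of c a] l[of c b] r[of a c] r[of b c] s[of a] s[of b] that by simp
  have eq: "equiv UNIV {(a, b). h \<squnion> a = h \<squnion> b}"
    by (auto simp: equiv_def refl_on_def sym_def trans_def)
  show ?thesis
    unfolding star_congruence_def quantale_congruence_def using eq S m by blast
qed

text \<open>
  Multiplication of \<open>l * a * r\<close> by an element next to \<open>a\<close> can be absorbed into \<open>l\<close> or \<open>r\<close>, and
  the involution exchanges left-sided and right-sided elements.
\<close>

lemma star_congruence_faithful:
  "star_congruence {(a::'a::star_quantale, b). \<forall>l\<in>left_sided. \<forall>r\<in>right_sided.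
     l * a * r = l * b * r}"
  (is "star_congruence ?R")
proof -
  have l: "l * c \<in> left_sided" if "l \<in> left_sided" for l c :: 'a
    using that by (auto simp: left_sided_def intro: quantale_mult_mono simp flip: mult.assoc)
  have r: "c * r \<in> right_sided" if "r \<in> right_sided" for r c :: 'a
    using that by (auto simp: right_sided_def intro: quantale_mult_mono simp: mult.assoc)
  have ls: "l\<^sup>\<star> \<in> right_sided" if "l \<in> left_sided" for l :: 'a
    using that star_mono[of "\<top> * l" l] by (auto simp: left_sided_def right_sided_def star_mult)
  have rs: "r\<^sup>\<star> \<in> left_sided" if "r \<in> right_sided" for r :: 'a
    using that star_mono[of "r * \<top>" r] by (auto simp: left_sided_def right_sided_def star_mult)
  have eq: "equiv UNIV ?R"
    by (auto simp: equiv_def refl_on_def sym_def trans_def)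
  have ml: "(c * a, c * b) \<in> ?R" if "(a, b) \<in> ?R" for a b c
    using that l by (auto simp flip: mult.assoc)
  have mr: "(a * c, b * c) \<in> ?R" if "(a, b) \<in> ?R" for a b c
    using that r by (auto simp: mult.assoc)
  have S: "(Sup (fst ` S), Sup (snd ` S)) \<in> ?R" if "S \<subseteq> ?R" for S
  proof -
    have "(\<lambda>z. l * fst z * r) ` S = (\<lambda>z. l * snd z * r) ` S"
      if "l \<in> left_sided" "r \<in> right_sided" for l r
      using that \<open>S \<subseteq> ?R\<close> by (intro image_cong) auto
    then show ?thesis by (auto simp: mult_Sup Sup_mult image_image)
  qed
  have st: "(a\<^sup>\<star>, b\<^sup>\<star>) \<in> ?R" if "(a, b) \<in> ?R" for a b
  proof -
    have "l * a\<^sup>\<star> * r = l * b\<^sup>\<star> * r" if "l \<in> left_sided" "r \<in> right_sided" for l r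
    proof -
      have "r\<^sup>\<star> * a * l\<^sup>\<star> = r\<^sup>\<star> * b * l\<^sup>\<star>"
        using \<open>(a, b) \<in> ?R\<close> ls rs that by auto
      then have "(r\<^sup>\<star> * a * l\<^sup>\<star>)\<^sup>\<star> = (r\<^sup>\<star> * b * l\<^sup>\<star>)\<^sup>\<star>" by simp
      then show ?thesis by (simp add: star_mult star_star mult.assoc)
    qed
    then show ?thesis by auto
  qed
  show ?thesis
    unfolding star_congruence_def quantale_congruence_def using eq ml mr S st by blast
qed

lemma hermitian_two_sided_bot_top:
  "(\<bottom>::'a::star_quantale) \<in> hermitian_two_sided" "(\<top>::'a) \<in> hermitian_two_sided"
  by (simp_all add: hermitian_two_sided_def two_sided_def left_sided_def right_sided_def
        hermitian_def)

lemma star_simple_imp_faithful_factor: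
  assumes "star_simple TYPE('a::star_quantale)"
  shows "strictly_faithful TYPE('a) \<and> star_factor TYPE('a)"
proof -
  have nz: "(\<top>::'a) * \<top> \<noteq> \<bottom>"
    and simple: "\<And>R :: ('a \<times> 'a) set. star_congruence R \<Longrightarrow> R = Id \<or> R = UNIV"
    using assms by (auto simp: star_simple_iff)
  have bt: "(\<bottom>::'a) \<noteq> \<top>" using nz by (metis mult_bot)
  have ht: "h = \<bottom> \<or> h = \<top>" if "h \<in> hermitian_two_sided" for h :: 'a
    using simple[OF star_congruence_sup_hermitian[OF that]]
  proof
    assume "{(a, b). h \<squnion> a = h \<squnion> b} = Id"
    moreover have "(h, \<bottom>) \<in> {(a, b). h \<squnion> a = h \<squnion> b}" by simp
    ultimately show ?thesis by auto
  next
    assume "{(a, b). h \<squnion> a = h \<squnion> b} = UNIV"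
    then have "(\<bottom>, \<top>) \<in> {(a, b). h \<squnion> a = h \<squnion> b}" by simp
    then show ?thesis by simp
  qed
  then have factor: "star_factor TYPE('a)"
    using bt hermitian_two_sided_bot_top by (auto simp: star_factor_def)
  have "(\<top>::'a) * \<top> \<in> hermitian_two_sided"
    using quantale_mult_mono[OF top_greatest order_refl, of "\<top>::'a" "\<top>"]
    by (auto simp: hermitian_two_sided_def hermitian_def two_sided_def left_sided_def
        right_sided_def star_mult intro!: quantale_mult_mono)
  then have tt: "(\<top>::'a) * \<top> = \<top>" using ht nz by blast
  let ?R = "{(a::'a, b). \<forall>l\<in>left_sided. \<forall>r\<in>right_sided. l * a * r = l * b * r}"
  have "(\<bottom>, \<top>) \<notin> ?R"
  proof
    assume "(\<bottom>, \<top>) \<in> ?R"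
    then have "(\<top>::'a) * \<bottom> * \<top> = \<top> * \<top> * \<top>" using top_left_sided top_right_sided by blast
    then show False using bt by (simp add: tt)
  qed
  then have "?R = Id" using simple[OF star_congruence_faithful] by blast
  then have "strictly_faithful TYPE('a)" unfolding strictly_faithful_def by blast
  with factor show ?thesis by blast
qed

section \<open>Two-sided elements of a strictly faithful factor\<close>

text \<open>The parameter only serves to fix the type.\<close>

locale faithful_factor =
  fixes ty :: "'a::star_quantale itself"
  assumes faithful: "\<And>a b :: 'a. (\<And>l r. l \<in> left_sided \<Longrightarrow> r \<in> right_sided \<Longrightarrow>
      l * a * r = l * b * r) \<Longrightarrow> a = b"
    and hermitian_cases: "\<And>h :: 'a. h \<in> two_sided \<Longrightarrow> h\<^sup>\<star> = h \<Longrightarrow> h = \<bottom> \<or> h = \<top>"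
    and bot_neq_top: "(\<bottom>::'a) \<noteq> \<top>"
begin

lemma top_mult_top_eq_bot:
  fixes x :: 'a
  assumes "\<top> * x * \<top> = \<bottom>"
  shows "x = \<bottom>"
proof (rule faithful)
  fix l r :: 'a
  have "l * x * r \<le> \<bottom>" using mult_mult_le_top[of l x r] assms by simp
  then show "l * x * r = l * \<bottom> * r" by (simp add: le_bot)
qed

lemma top_top [simp]: "(\<top>::'a) * \<top> = \<top>"
proof -
  have "(\<top>::'a) * \<top> \<in> two_sided"
    by (intro two_sided_mult) (simp_all add: two_sided_def top_left_sided top_right_sided)
  then have "(\<top>::'a) * \<top> = \<bottom> \<or> (\<top>::'a) * \<top> = \<top>" by (rule hermitian_cases) (simp add: star_mult)
  moreover have "(\<top>::'a) * \<top> \<noteq> \<bottom>"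
    using top_mult_top_eq_bot[of \<top>] bot_neq_top by auto
  ultimately show ?thesis by blast
qed

definition proper :: "'a \<Rightarrow> bool" where
  "proper u \<longleftrightarrow> u \<in> two_sided \<and> u \<noteq> \<bottom> \<and> u \<noteq> \<top>"

lemma proper_star:
  assumes "proper u"
  shows "proper (u\<^sup>\<star>)"
proof -
  have "u\<^sup>\<star> \<noteq> \<bottom>" "u\<^sup>\<star> \<noteq> \<top>"
    using assms star_star[of u] by (auto simp: proper_def)
  then show ?thesis using assms by (simp add: proper_def two_sided_star)
qed

lemma proper_sup_star:
  assumes "proper u"
  shows "u \<squnion> u\<^sup>\<star> = \<top>"
proof -
  have "u \<squnion> u\<^sup>\<star> = \<bottom> \<or> u \<squnion> u\<^sup>\<star> = \<top>"
    using assms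
    by (intro hermitian_cases two_sided_sup two_sided_star)
       (simp_all add: proper_def star_sup star_star sup_commute)
  then show ?thesis using assms by (auto simp: proper_def)
qed

lemma proper_inf_star:
  assumes "proper u"
  shows "u \<sqinter> u\<^sup>\<star> = \<bottom>"
proof -
  have "u \<sqinter> u\<^sup>\<star> = \<bottom> \<or> u \<sqinter> u\<^sup>\<star> = \<top>"
    using assms
    by (intro hermitian_cases two_sided_inf two_sided_star)
       (simp_all add: proper_def star_inf star_star inf_commute)
  then show ?thesis using assms by (auto simp: proper_def)
qed

lemma proper_mult_star:
  assumes "proper u"
  shows "u * u\<^sup>\<star> = \<bottom>" "u\<^sup>\<star> * u = \<bottom>"
  using assms two_sided_mult_le_inf[of u "u\<^sup>\<star>"] two_sided_mult_le_inf[of "u\<^sup>\<star>" u]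
    proper_inf_star[OF assms]
  by (simp_all add: proper_def two_sided_star inf_commute le_bot)

lemma proper_mult_top:
  assumes "proper u"
  shows "u * \<top> = u * u" "\<top> * u = u * u"
  using mult_sup[of u u "u\<^sup>\<star>"] sup_mult[of u "u\<^sup>\<star>" u] proper_mult_star[OF assms]
    proper_sup_star[OF assms]
  by simp_all

text \<open>
  As \<open>u\<^sup>\<star> * v \<le> v\<^sup>\<star> * v = \<bottom>\<close>, multiplying \<open>v\<close> by \<open>u\<close> from the left amounts to multiplying it
  by \<open>\<top>\<close>; symmetrically for multiplying \<open>u\<close> by \<open>v\<close> from the right. So both squares equal
  \<open>u * v\<close>.
\<close>

lemma proper_le_square_eq:
  assumes u: "proper u" and v: "proper v" and le: "u \<le> v"
  shows "u * u = v * v"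
proof -
  have "u\<^sup>\<star> * v \<le> v\<^sup>\<star> * v" using le by (intro quantale_mult_mono star_mono) auto
  then have "u\<^sup>\<star> * v = \<bottom>" using proper_mult_star[OF v] by (simp add: le_bot)
  then have uv: "\<top> * v = u * v" by (metis sup_mult proper_sup_star[OF u] sup_bot_right)
  have "u * v\<^sup>\<star> \<le> v * v\<^sup>\<star>" using le by (intro quantale_mult_mono) auto
  then have "u * v\<^sup>\<star> = \<bottom>" using proper_mult_star[OF v] by (simp add: le_bot)
  then have "u * \<top> = u * v" by (metis mult_sup proper_sup_star[OF v] sup_bot_right)
  then show ?thesis using uv proper_mult_top[OF u] proper_mult_top[OF v] by simp
qed

text \<open>
  Strict faithfulness reduces the claim to \<open>l * (u * u) * r = l * u * r\<close>. Both sides are two-sided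
  and below \<open>u\<close>, so each is either \<open>\<bottom>\<close> or squeezed to \<open>u * u\<close> by \<open>proper_le_square_eq\<close>.
\<close>

lemma proper_idem:
  assumes u: "proper u"
  shows "u * u = u"
proof (rule faithful)
  fix l r :: 'a assume lr: "l \<in> left_sided" "r \<in> right_sided"
  have ts: "u \<in> two_sided" using u by (simp add: proper_def)
  have cube: "u * u * u = u * u"
    using proper_mult_top[OF u] by (metis mult.assoc top_top)
  have up: "l * u * r \<le> u * u"
    using mult_mult_le_top[of l u r] proper_mult_top[OF u] cube by (simp add: mult.assoc)
  have "l * (u * u) * r \<le> l * u * r"
    using two_sidedD(1)[OF ts] by (intro quantale_mult_mono) auto
  moreover have "l * u * r \<le> l * (u * u) * r"
  proof (cases "l * u * r = \<bottom>")
    case False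
    have "l * u * r \<noteq> \<top>" using two_sidedD(3)[OF ts, of l r] u by (auto simp: proper_def top_unique)
    then have w: "proper (l * u * r)"
      using False left_right_sided_mult_two_sided[OF lr] by (simp add: proper_def)
    have "u * u = (l * u * r) * (l * u * r)"
      using proper_le_square_eq[OF w u two_sidedD(3)[OF ts]] by simp
    also have "\<dots> \<le> l * u * r" using w by (simp add: proper_def two_sidedD)
    finally have *: "u * u \<le> l * u * r" .
    \<comment> \<open>The factors \<open>r\<close> and \<open>l\<close> in turn may be enlarged to \<open>\<top>\<close>.\<close>
    have 1: "u * u \<le> l * (u * u)"
      using * quantale_mult_mono[OF order_refl top_greatest, of "l * u" r] proper_mult_top[OF u]
      by (simp add: mult.assoc)
    have 2: "u * u \<le> (u * u) * r"
      using * quantale_mult_mono[OF top_greatest order_refl, of l "u * r"] proper_mult_top[OF u]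
      by (simp flip: mult.assoc)
    have "l * u * r \<le> u * u" by (rule up)
    also have "\<dots> \<le> (u * u) * r" by (rule 2)
    also have "\<dots> \<le> l * (u * u) * r" by (rule quantale_mult_mono[OF 1 order_refl])
    finally show ?thesis .
  qed simp
  ultimately show "l * (u * u) * r = l * u * r" by (rule antisym)
qed

lemma proper_le_eq: "proper u \<Longrightarrow> proper v \<Longrightarrow> u \<le> v \<Longrightarrow> u = v"
  by (metis proper_idem proper_le_square_eq)

text \<open>
  Since \<open>s = s * (t \<squnion> t\<^sup>\<star>)\<close>, one of \<open>s * t\<close> and \<open>s * t\<^sup>\<star>\<close> is nonzero. This product lies
  below both factors, hence equals both by \<open>proper_le_eq\<close>.
\<close>

lemma proper_cases:
  assumes s: "proper s" and t: "proper t"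
  shows "s = t \<or> s = t\<^sup>\<star>"
proof -
  have *: "s = v" if v: "proper v" and nz: "s * v \<noteq> \<bottom>" for v
  proof -
    have le: "s * v \<le> s" "s * v \<le> v" using s v by (simp_all add: proper_def two_sidedD)
    then have "proper (s * v)" using s v nz two_sided_mult[of s v] by (auto simp: proper_def top_unique)
    then show ?thesis using le proper_le_eq s v by metis
  qed
  have "s * t \<squnion> s * t\<^sup>\<star> = s"
    by (metis mult_sup proper_sup_star[OF t] proper_mult_top(1)[OF s] proper_idem[OF s])
  then have "s * t \<noteq> \<bottom> \<or> s * t\<^sup>\<star> \<noteq> \<bottom>" using s by (auto simp: proper_def)
  then show ?thesis using * t proper_star by blast
qed

text \<open>
  The third and the fourth conjunct together make \<open>\<pi>\<close> prime, in the sense that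
  \<open>b * \<top> * x * \<top> * a \<le> \<pi>\<close> implies \<open>x \<le> \<pi>\<close> or \<open>b * \<top> * a \<le> \<pi>\<close>; cyclicity of the set of
  residuals of \<open>\<pi>\<close> rests on this. The last conjunct makes that set *-separating.
\<close>

definition separating_prime :: "'a \<Rightarrow> bool" where
  "separating_prime \<pi> \<longleftrightarrow> \<pi> \<in> two_sided \<and> \<pi> \<noteq> \<top> \<and>
     (\<forall>x. \<top> * x * \<top> \<le> \<pi> \<longrightarrow> x \<le> \<pi>) \<and>
     (\<forall>s\<in>two_sided. \<not> s \<le> \<pi> \<longrightarrow> s \<squnion> \<pi> = \<top>) \<and>
     (\<forall>u\<in>two_sided. \<forall>v\<in>two_sided. \<not> v \<le> u \<longrightarrow>
        u \<le> \<pi> \<and> \<not> v \<le> \<pi> \<or> u \<le> \<pi>\<^sup>\<star> \<and> \<not> v \<le> \<pi>\<^sup>\<star>)"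

text \<open>
  Each \<open>l * x * r\<close> is \<open>\<bottom>\<close> or \<open>t\<close>, and in the second case \<open>t \<le> l * t\<close> and \<open>t \<le> t * r\<close>, so that
  \<open>l * t * r\<close> is \<open>t\<close> as well. Strict faithfulness turns this into \<open>x \<le> t\<close>.
\<close>

lemma proper_top_mult_top_le:
  assumes t: "proper t" and x: "\<top> * x * \<top> \<le> t"
  shows "x \<le> t"
proof -
  have ts: "t \<in> two_sided" using t by (simp add: proper_def)
  have idem: "t * t = t" by (rule proper_idem[OF t])
  have "x \<squnion> t = t"
  proof (rule faithful)
    fix l r :: 'a assume lr: "l \<in> left_sided" "r \<in> right_sided"
    have "l * x * r \<le> l * t * r"
    proof (cases "l * x * r = \<bottom>")
      case False
      have le: "l * x * r \<le> t" using x mult_mult_le_top order_trans by blast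
      then have "l * x * r \<noteq> \<top>" using t by (auto simp: proper_def top_unique)
      then have "proper (l * x * r)"
        using False left_right_sided_mult_two_sided[OF lr] by (simp add: proper_def)
      then have lxr: "l * x * r = t" using t le by (rule proper_le_eq)
      \<comment> \<open>Only the \<open>t\<close> part of \<open>\<top> = t \<squnion> t\<^sup>\<star>\<close> contributes next to \<open>x\<close>.\<close>
      have "l * x * t\<^sup>\<star> \<le> t \<sqinter> t\<^sup>\<star>"
        using x mult_mult_le_top[of l x "t\<^sup>\<star>"] two_sidedD(2)[OF two_sided_star[OF ts], of "l * x"]
        by (auto intro: order_trans)
      then have "l * x * t\<^sup>\<star> = \<bottom>" using proper_inf_star[OF t] by (simp add: le_bot)
      then have "l * x * \<top> = l * x * t" by (metis mult_sup proper_sup_star[OF t] sup_bot_right)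
      also have "\<dots> \<le> l * t"
        using quantale_mult_mono[OF order_refl two_sidedD(2)[OF ts, of x], of l]
        by (simp add: mult.assoc)
      finally have 1: "t \<le> l * t"
        using quantale_mult_mono[OF order_refl top_greatest, of "l * x" r] lxr by simp
      have "t\<^sup>\<star> * x * r \<le> t \<sqinter> t\<^sup>\<star>"
        using x mult_mult_le_top[of "t\<^sup>\<star>" x r] two_sidedD(1)[OF two_sided_star[OF ts], of "x * r"]
        by (auto intro: order_trans simp: mult.assoc)
      then have "t\<^sup>\<star> * x * r = \<bottom>" using proper_inf_star[OF t] by (simp add: le_bot)
      then have "\<top> * x * r = t * x * r" by (metis sup_mult proper_sup_star[OF t] sup_bot_right)
      also have "\<dots> \<le> t * r"
        using two_sidedD(1)[OF ts, of x] by (intro quantale_mult_mono) auto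
      finally have 2: "t \<le> t * r"
        using quantale_mult_mono[OF top_greatest order_refl, of l "x * r"] lxr
        by (simp add: mult.assoc)
      have "t \<le> l * t * r" using 2 quantale_mult_mono[OF 1 order_refl, of r] by (rule order_trans)
      then show ?thesis by (simp add: lxr)
    qed simp
    then show "l * (x \<squnion> t) * r = l * t * r" by (simp add: mult_sup sup_mult sup.absorb2)
  qed
  then show ?thesis by (simp add: sup.absorb_iff2)
qed

lemma separating_prime_proper:
  assumes t: "proper t"
  shows "separating_prime t"
proof -
  have cs: "s = \<bottom> \<or> s = \<top> \<or> s = t \<or> s = t\<^sup>\<star>" if "s \<in> two_sided" for s
    using that proper_cases[OF _ t] by (auto simp: proper_def)
  have props: "t \<in> two_sided" "t \<noteq> \<bottom>" "t \<noteq> \<top>" using t by (auto simp: proper_def)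
  have sp: "t\<^sup>\<star> \<squnion> t = \<top>" using proper_sup_star[OF t] by (simp add: sup_commute)
  have nle: "\<not> t \<le> t\<^sup>\<star>" "\<not> t\<^sup>\<star> \<le> t"
    using proper_inf_star[OF t] props proper_star[OF t]
    by (auto simp: proper_def inf.absorb1 inf.absorb2)
  have nt: "t\<^sup>\<star> \<noteq> \<bottom>" "t\<^sup>\<star> \<noteq> \<top>" using proper_star[OF t] by (auto simp: proper_def)
  have 3: "s \<squnion> t = \<top>" if "s \<in> two_sided" "\<not> s \<le> t" for s
    using cs[OF that(1)] that(2) sp by auto
  have 4: "u \<le> t \<and> \<not> v \<le> t \<or> u \<le> t\<^sup>\<star> \<and> \<not> v \<le> t\<^sup>\<star>"
    if "u \<in> two_sided" "v \<in> two_sided" "\<not> v \<le> u" for u v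
    using cs[OF that(1)] cs[OF that(2)] that(3) nle props nt by (auto simp: top_unique le_bot)
  show ?thesis
    unfolding separating_prime_def using props 3 4 proper_top_mult_top_le[OF t] by blast
qed

lemma ex_separating_prime: "\<exists>\<pi>. separating_prime \<pi>"
proof (cases "\<exists>t. proper t")
  case False
  then have cs: "s = \<bottom> \<or> s = \<top>" if "s \<in> two_sided" for s :: 'a
    using that by (auto simp: proper_def)
  have "\<bottom> \<in> (two_sided :: 'a set)" by (simp add: two_sided_def left_sided_def right_sided_def)
  moreover have "s \<squnion> \<bottom> = \<top>" if "s \<in> two_sided" "\<not> s \<le> \<bottom>" for s :: 'a
    using cs that by fastforce
  moreover have "u \<le> \<bottom> \<and> \<not> v \<le> \<bottom>" if "u \<in> two_sided" "v \<in> two_sided" "\<not> v \<le> u" for u v :: 'a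
    using cs[of u] cs[of v] that bot_neq_top by (auto simp: le_bot)
  ultimately have "separating_prime \<bottom>"
    using bot_neq_top top_mult_top_eq_bot unfolding separating_prime_def by (metis le_bot order_refl)
  then show ?thesis by blast
qed (auto intro: separating_prime_proper)

section \<open>A cyclic separating set from a strictly faithful factor\<close>

definition residuals :: "'a \<Rightarrow> 'a set" where
  "residuals \<pi> = {(a \<rightarrow>\<^sub>q \<pi>) \<leftarrow>\<^sub>q b | a b. True} - {\<top>}"

text \<open>
  Residuals of residuals of \<open>\<pi>\<close> are residuals of \<open>\<pi>\<close>, so it is enough to recover \<open>\<pi>\<close> from each
  member \<open>p = a \<rightarrow>\<^sub>q \<pi> \<leftarrow>\<^sub>q b\<close>. It is \<open>\<top> \<rightarrow>\<^sub>q p \<leftarrow>\<^sub>q \<top>\<close>: if \<open>x\<close> is not below \<open>\<pi>\<close>, then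
  \<open>\<top> * x * \<top> \<squnion> \<pi> = \<top>\<close>, so that \<open>b * (\<top> * x * \<top>) * a \<le> \<pi>\<close> would imply \<open>b * \<top> * a \<le> \<pi>\<close>, which
  means \<open>p = \<top>\<close>.
\<close>

lemma cyclic_residuals:
  assumes g: "separating_prime \<pi>"
  shows "cyclic (residuals \<pi>)"
proof -
  have ts: "\<pi> \<in> two_sided" and nt: "\<pi> \<noteq> \<top>"
    and prime: "\<And>x. \<top> * x * \<top> \<le> \<pi> \<Longrightarrow> x \<le> \<pi>"
    and maximal: "\<And>s. s \<in> two_sided \<Longrightarrow> \<not> s \<le> \<pi> \<Longrightarrow> s \<squnion> \<pi> = \<top>"
    using g unfolding separating_prime_def by blast+
  have "\<pi> = (\<top> \<rightarrow>\<^sub>q \<pi>) \<leftarrow>\<^sub>q \<top>"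
    unfolding eq_residual_iff using prime two_sidedD(3)[OF ts]
    by (meson order_refl order_trans quantale_mult_mono)
  then have ne: "residuals \<pi> \<noteq> {}" using nt unfolding residuals_def by blast
  have "{(c \<rightarrow>\<^sub>q p) \<leftarrow>\<^sub>q d | c d. True} = residuals \<pi> \<union> {\<top>}" if p: "p \<in> residuals \<pi>" for p
  proof -
    obtain a b where pab: "p = (a \<rightarrow>\<^sub>q \<pi>) \<leftarrow>\<^sub>q b" and "p \<noteq> \<top>"
      using p by (auto simp: residuals_def)
    have le_p: "x \<le> p \<longleftrightarrow> b * x * a \<le> \<pi>" for x using pab by (simp add: le_residual_iff)
    have bta: "\<not> b * \<top> * a \<le> \<pi>" using \<open>p \<noteq> \<top>\<close> le_p[of \<top>] by (auto simp: top_unique)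
    have recover: "\<top> * x * \<top> \<le> p \<longleftrightarrow> x \<le> \<pi>" for x
    proof
      assume "x \<le> \<pi>"
      then have "b * (\<top> * x * \<top>) * a \<le> b * (\<top> * \<pi> * \<top>) * a"
        by (intro quantale_mult_mono) auto
      also have "\<dots> \<le> \<pi>" using two_sidedD(3)[OF ts, of "b * \<top>" "\<top> * a"] by (simp add: mult.assoc)
      finally show "\<top> * x * \<top> \<le> p" by (simp add: le_p)
    next
      assume "\<top> * x * \<top> \<le> p"
      then have x: "b * (\<top> * x * \<top>) * a \<le> \<pi>" by (simp add: le_p)
      show "x \<le> \<pi>"
      proof (rule ccontr)
        assume "\<not> x \<le> \<pi>"
        then have "\<not> \<top> * x * \<top> \<le> \<pi>" using prime by blast
        then have "\<top> * x * \<top> \<squnion> \<pi> = \<top>" by (intro maximal top_mult_top_two_sided)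
        then have "b * \<top> * a = b * (\<top> * x * \<top>) * a \<squnion> b * \<pi> * a"
          by (metis mult_sup sup_mult)
        also have "\<dots> \<le> \<pi>" using x two_sidedD(3)[OF ts] by simp
        finally show False using bta by simp
      qed
    qed
    show ?thesis
    proof (intro set_eqI iffI)
      fix q assume "q \<in> {(c \<rightarrow>\<^sub>q p) \<leftarrow>\<^sub>q d | c d. True}"
      then obtain c d where "q = (c \<rightarrow>\<^sub>q p) \<leftarrow>\<^sub>q d" by blast
      then have "q = ((c * a) \<rightarrow>\<^sub>q \<pi>) \<leftarrow>\<^sub>q (b * d)"
        unfolding eq_residual_iff by (simp add: le_p mult.assoc)
      then show "q \<in> residuals \<pi> \<union> {\<top>}" unfolding residuals_def by blast
    next
      fix q assume "q \<in> residuals \<pi> \<union> {\<top>}"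
      then consider "q = \<top>" | c d where "q = (c \<rightarrow>\<^sub>q \<pi>) \<leftarrow>\<^sub>q d" by (auto simp: residuals_def)
      then show "q \<in> {(c \<rightarrow>\<^sub>q p) \<leftarrow>\<^sub>q d | c d. True}"
      proof cases
        case 1
        then have "q = (\<bottom> \<rightarrow>\<^sub>q p) \<leftarrow>\<^sub>q \<bottom>" unfolding eq_residual_iff by simp
        then show ?thesis by blast
      next
        case 2
        then have "q = ((c * \<top>) \<rightarrow>\<^sub>q p) \<leftarrow>\<^sub>q (\<top> * d)"
          unfolding eq_residual_iff by (metis mult.assoc recover)
        then show ?thesis by blast
      qed
    qed
  qed
  then show ?thesis using ne by (auto simp: cyclic_def residuals_def)
qed

lemma star_separating_residuals:
  assumes g: "separating_prime \<pi>"
  shows "star_separating (residuals \<pi>)"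
  unfolding star_separating_def separating_def
proof (intro allI impI)
  fix a b :: 'a assume "\<not> b \<le> a"
  then have "a \<noteq> a \<squnion> b" by (metis sup.cobounded2)
  then obtain l r where lr: "l \<in> left_sided" "r \<in> right_sided"
    and neq: "l * a * r \<noteq> l * (a \<squnion> b) * r"
    using faithful by blast
  have split: "l * (a \<squnion> b) * r = l * a * r \<squnion> l * b * r" by (simp add: mult_sup sup_mult)
  have nle: "\<not> l * b * r \<le> l * a * r" using neq split by (metis sup.absorb1)
  have "l * a * r \<le> \<pi> \<and> \<not> l * b * r \<le> \<pi> \<or> l * a * r \<le> \<pi>\<^sup>\<star> \<and> \<not> l * b * r \<le> \<pi>\<^sup>\<star>"
    using g nle left_right_sided_mult_two_sided[OF lr] unfolding separating_prime_def by blast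
  then show "\<exists>p\<in>residuals \<pi> \<union> star ` residuals \<pi>. a \<le> p \<and> \<not> b \<le> p"
  proof
    assume *: "l * a * r \<le> \<pi> \<and> \<not> l * b * r \<le> \<pi>"
    let ?p = "(r \<rightarrow>\<^sub>q \<pi>) \<leftarrow>\<^sub>q l"
    have p: "a \<le> ?p" "\<not> b \<le> ?p" using * by (simp_all add: le_residual_iff)
    then have "?p \<in> residuals \<pi>" unfolding residuals_def by force
    with p show ?thesis by blast
  next
    assume *: "l * a * r \<le> \<pi>\<^sup>\<star> \<and> \<not> l * b * r \<le> \<pi>\<^sup>\<star>"
    let ?p = "(l\<^sup>\<star> \<rightarrow>\<^sub>q \<pi>) \<leftarrow>\<^sub>q r\<^sup>\<star>"
    have st: "(l * x * r)\<^sup>\<star> = r\<^sup>\<star> * x\<^sup>\<star> * l\<^sup>\<star>" for x by (simp add: star_mult mult.assoc)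
    have p: "a \<le> ?p\<^sup>\<star>" "\<not> b \<le> ?p\<^sup>\<star>"
      using * by (simp_all add: le_residual_iff st flip: star_le_iff)
    then have "?p \<noteq> \<top>" by force
    then have "?p \<in> residuals \<pi>" unfolding residuals_def by blast
    with p show ?thesis by blast
  qed
qed

end

lemma faithful_factor_imp_cyclic:
  assumes "strictly_faithful TYPE('a::star_quantale)" "star_factor TYPE('a)"
  shows "\<exists>P :: 'a set. star_separating P \<and> cyclic P"
proof -
  interpret faithful_factor "TYPE('a)"
  proof
    show "a = b" if "\<And>l r. l \<in> left_sided \<Longrightarrow> r \<in> right_sided \<Longrightarrow> l * a * r = l * b * r" for a b :: 'a
      using assms(1) that unfolding strictly_faithful_def by blast
    show "h = \<bottom> \<or> h = \<top>" if "h \<in> two_sided" "h\<^sup>\<star> = h" for h :: 'a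
      using assms(2) that by (auto simp: star_factor_def hermitian_two_sided_def hermitian_def)
    show "(\<bottom>::'a) \<noteq> \<top>" using assms(2) by (simp add: star_factor_def)
  qed
  show ?thesis using ex_separating_prime cyclic_residuals star_separating_residuals by blast
qed

section \<open>Simplicity from a cyclic separating set\<close>

text \<open>
  Since \<open>b * x * a \<le> \<top> * x * \<top>\<close>, the inequality \<open>\<top> * x * \<top> \<le> p\<close> says that \<open>x\<close> is below all
  residuals \<open>a \<rightarrow>\<^sub>q p \<leftarrow>\<^sub>q b\<close> of \<open>p\<close>, that is, below all of \<open>P\<close>. Hence the residual
  \<open>\<top> \<rightarrow>\<^sub>q p \<leftarrow>\<^sub>q \<top>\<close> is the meet of \<open>P\<close>; in particular it does not depend on \<open>p\<close>, and it lies
  in \<open>P\<close> because it is not \<open>\<top>\<close>.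
\<close>

lemma cyclic_least:
  fixes P :: "'a::quantale set"
  assumes "cyclic P"
  obtains \<pi> where "\<pi> \<in> P" "\<And>p x. p \<in> P \<Longrightarrow> \<top> * x * \<top> \<le> p \<longleftrightarrow> x \<le> \<pi>"
    "\<And>p. p \<in> P \<Longrightarrow> \<pi> \<le> p"
proof -
  have ne: "P \<noteq> {}" and nt: "\<top> \<notin> P"
    and res: "\<And>p. p \<in> P \<Longrightarrow> {(a \<rightarrow>\<^sub>q p) \<leftarrow>\<^sub>q b | a b. True} = P \<union> {\<top>}"
    using assms unfolding cyclic_def by blast+
  have below: "\<top> * x * \<top> \<le> p \<longleftrightarrow> x \<le> \<Sqinter>P" if p: "p \<in> P" for p x
  proof
    assume x: "\<top> * x * \<top> \<le> p"
    show "x \<le> \<Sqinter>P"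
    proof (rule Inf_greatest)
      fix q assume "q \<in> P"
      then obtain a b where "q = (a \<rightarrow>\<^sub>q p) \<leftarrow>\<^sub>q b" using res[OF p] by blast
      then show "x \<le> q" using x mult_mult_le_top[of b x a] by (simp add: le_residual_iff)
    qed
  next
    assume x: "x \<le> \<Sqinter>P"
    have "(\<top> \<rightarrow>\<^sub>q p) \<leftarrow>\<^sub>q \<top> \<in> P \<union> {\<top>}" using res[OF p] by blast
    then have "x \<le> (\<top> \<rightarrow>\<^sub>q p) \<leftarrow>\<^sub>q \<top>" using x by (auto intro: order_trans Inf_lower)
    then show "\<top> * x * \<top> \<le> p" by (simp add: le_residual_iff)
  qed
  obtain p where p: "p \<in> P" using ne by blast
  have "\<Sqinter>P = (\<top> \<rightarrow>\<^sub>q p) \<leftarrow>\<^sub>q \<top>" unfolding eq_residual_iff using below[OF p] by simp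
  then have "\<Sqinter>P \<in> P \<union> {\<top>}" using res[OF p] by blast
  moreover have "\<Sqinter>P \<noteq> \<top>" using p nt by (metis Inf_lower top_unique)
  ultimately have "\<Sqinter>P \<in> P" by blast
  then show thesis using that below by (meson Inf_lower)
qed

text \<open>
  The separation property is applied to \<open>P\<close> and the pair \<open>a\<^sup>\<star>, b\<^sup>\<star>\<close> in place of members of
  \<open>star ` P\<close>, so that cyclicity is available throughout. An element with neither it nor its star
  below any member of \<open>P\<close> must then be \<open>\<top>\<close>.
\<close>

lemma cyclic_imp_star_simple:
  fixes P :: "'a::star_quantale set"
  assumes sep: "star_separating P" and cyc: "cyclic P"
  shows "star_simple TYPE('a)"
proof -
  obtain \<pi> where \<pi>: "\<pi> \<in> P" and below: "\<And>p x. p \<in> P \<Longrightarrow> \<top> * x * \<top> \<le> p \<longleftrightarrow> x \<le> \<pi>"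
    and least: "\<And>p. p \<in> P \<Longrightarrow> \<pi> \<le> p"
    using cyclic_least[OF cyc] by blast
  have nt: "\<top> \<notin> P" using cyc by (simp add: cyclic_def)
  have sepD: "\<exists>p\<in>P. a \<le> p \<and> \<not> b \<le> p \<or> a\<^sup>\<star> \<le> p \<and> \<not> b\<^sup>\<star> \<le> p" if "\<not> b \<le> a" for a b :: 'a
  proof -
    have "\<exists>q\<in>P \<union> star ` P. a \<le> q \<and> \<not> b \<le> q"
      using sep[unfolded star_separating_def separating_def, rule_format, OF that] .
    then obtain q where "q \<in> P \<union> star ` P" and q: "a \<le> q" "\<not> b \<le> q" by blast
    then consider "q \<in> P" | p where "p \<in> P" "q = p\<^sup>\<star>" by blast
    then show ?thesis
    proof cases
      case 1
      with q show ?thesis by blast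
    next
      case 2
      with q have "a\<^sup>\<star> \<le> p" "\<not> b\<^sup>\<star> \<le> p" by (simp_all only: star_le_iff not_False_eq_True)
      with 2 show ?thesis by blast
    qed
  qed
  have eq_top: "a = \<top>" if "\<And>p. p \<in> P \<Longrightarrow> \<not> a \<le> p \<and> \<not> a\<^sup>\<star> \<le> p" for a :: 'a
    using sepD[of \<top> a] that by (auto simp: top_unique)
  have two: "\<top> * \<pi> * \<top> \<le> \<pi>" using below[OF \<pi>] by blast
  have ntop: "\<not> \<top> \<le> \<pi>" using \<pi> nt by (auto simp: top_unique)
  have "\<not> \<top> * \<top> \<le> p" if p: "p \<in> P" for p
  proof
    assume "\<top> * \<top> \<le> p"
    moreover have "(\<top>::'a) * \<top> * \<top> \<le> \<top> * \<top>" by (intro quantale_mult_mono) auto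
    ultimately have "\<top> * \<top> * \<top> \<le> p" by (rule order_trans[rotated])
    then show False using below[OF p] ntop by blast
  qed
  then have tt: "(\<top>::'a) * \<top> = \<top>" by (intro eq_top) (simp add: star_mult)
  have inf: "\<pi> \<sqinter> \<pi>\<^sup>\<star> = \<bottom>"
  proof (rule ccontr)
    assume "\<pi> \<sqinter> \<pi>\<^sup>\<star> \<noteq> \<bottom>"
    then have "\<not> \<pi> \<sqinter> \<pi>\<^sup>\<star> \<le> \<bottom>" by (simp only: bot_unique not_False_eq_True)
    then obtain p where "p \<in> P" "\<not> \<pi> \<sqinter> \<pi>\<^sup>\<star> \<le> p \<or> \<not> (\<pi> \<sqinter> \<pi>\<^sup>\<star>)\<^sup>\<star> \<le> p" using sepD by blast
    moreover have "(\<pi> \<sqinter> \<pi>\<^sup>\<star>)\<^sup>\<star> \<le> \<pi>" "\<pi> \<sqinter> \<pi>\<^sup>\<star> \<le> \<pi>" by (simp_all add: star_inf star_star)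
    ultimately show False using least[of p] order_trans by blast
  qed
  have ts: "\<pi> \<in> two_sided"
  proof -
    have "\<top> * (\<top> * \<pi>) * \<top> \<le> \<pi>" "\<top> * (\<pi> * \<top>) * \<top> \<le> \<pi>"
      using two tt by (metis mult.assoc)+
    then have "\<top> * \<pi> \<le> \<pi>" "\<pi> * \<top> \<le> \<pi>" using below[OF \<pi>] by blast+
    then show ?thesis by (simp add: two_sided_def left_sided_def right_sided_def)
  qed
  have prod: "\<pi> * \<pi>\<^sup>\<star> = \<bottom>"
    using two_sided_mult_le_inf[OF ts two_sided_star[OF ts]] inf by (simp add: le_bot)
  have "R = Id \<or> R = UNIV" if R: "star_congruence R" for R :: "('a \<times> 'a) set"
  proof (rule disjCI)
    note cong = star_congruenceD[OF R]
    assume "R \<noteq> UNIV"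
    \<comment> \<open>Otherwise \<open>\<pi>\<close>, and then \<open>\<bottom>\<close>, would be congruent to \<open>\<top>\<close>.\<close>
    have key: "b \<le> p" if ab: "(a, b) \<in> R" and p: "p \<in> P" and ap: "a \<le> p" for a b p
    proof (rule ccontr)
      assume nbp: "\<not> b \<le> p"
      have "{(c \<rightarrow>\<^sub>q \<pi>) \<leftarrow>\<^sub>q d | c d. True} = P \<union> {\<top>}" using cyc \<pi> by (simp add: cyclic_def)
      then obtain c d where pcd: "p = (c \<rightarrow>\<^sub>q \<pi>) \<leftarrow>\<^sub>q d" using p by blast
      define x y where "x = d * a * c" and "y = d * b * c"
      have x: "x \<le> \<pi>" and y: "\<not> y \<le> \<pi>"
        using ap nbp by (simp_all add: pcd le_residual_iff x_def y_def)
      have "(\<top> * y * \<top>, \<top> * x * \<top>) \<in> R" unfolding x_def y_def by (intro cong(4) cong(2)[OF ab])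
      then have "(\<top> * y * \<top> \<squnion> \<pi>, \<top> * x * \<top> \<squnion> \<pi>) \<in> R" by (rule cong(6))
      moreover have "\<top> * x * \<top> \<squnion> \<pi> = \<pi>" using x below[OF \<pi>] by (simp add: sup.absorb2)
      moreover have "\<top> * y * \<top> \<squnion> \<pi> = \<top>"
      proof (rule eq_top, rule conjI)
        fix q assume q: "q \<in> P"
        show "\<not> \<top> * y * \<top> \<squnion> \<pi> \<le> q" using below[OF q] y by simp
        show "\<not> (\<top> * y * \<top> \<squnion> \<pi>)\<^sup>\<star> \<le> q"
        proof
          assume "(\<top> * y * \<top> \<squnion> \<pi>)\<^sup>\<star> \<le> q"
          then have "\<top> * y\<^sup>\<star> * \<top> \<le> q" "\<pi>\<^sup>\<star> \<le> q"
            by (simp_all add: star_sup star_mult mult.assoc)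
          moreover have "\<top> * \<pi>\<^sup>\<star> * \<top> \<le> \<pi>\<^sup>\<star>" by (rule two_sidedD(3)[OF two_sided_star[OF ts]])
          ultimately have "\<top> * \<pi>\<^sup>\<star> * \<top> \<le> q" by (metis order_trans)
          then have "y \<le> \<pi>\<^sup>\<star>" "\<pi>\<^sup>\<star> \<le> \<pi>"
            using \<open>\<top> * y\<^sup>\<star> * \<top> \<le> q\<close> below[OF q] by (simp_all flip: star_le_iff)
          then have "y \<le> \<pi>" by (rule order_trans)
          then show False using y by simp
        qed
      qed
      ultimately have tp: "(\<top>, \<pi>) \<in> R" by simp
      then have "(\<top>\<^sup>\<star>, \<pi>\<^sup>\<star>) \<in> R" by (rule cong(7))
      then have "(\<top> * \<top>, \<pi> * \<pi>\<^sup>\<star>) \<in> R" using cong(5)[OF tp, of \<top> "\<pi>\<^sup>\<star>"] by simp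
      then have tb: "(\<top>, \<bottom>) \<in> R" by (simp add: tt prod)
      have all: "(z, \<top>) \<in> R" for z
        using cong(6)[OF cong(2)[OF tb], of z] by simp
      have "(z, w) \<in> R" for z w using cong(3)[OF all cong(2)[OF all]] .
      then have "R = UNIV" by auto
      then show False using \<open>R \<noteq> UNIV\<close> by simp
    qed
    have le: "b \<le> a" if ab: "(a, b) \<in> R" for a b
      using sepD[of b a] key[OF ab] key[OF cong(7)[OF ab]] by blast
    show "R = Id"
    proof (intro equalityI subrelI)
      fix a b assume ab: "(a, b) \<in> R"
      then show "(a, b) \<in> Id" using le[OF ab] le[OF cong(2)[OF ab]] by simp
    qed (use cong(1) in auto)
  qed
  moreover have "(\<top>::'a) * \<top> \<noteq> \<bottom>" using tt ntop by (metis bot.extremum)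
  ultimately show ?thesis by (simp add: star_simple_iff)
qed

section \<open>The equivalence\<close>

theorem theorem3p4:
  shows "(star_simple TYPE('a::star_quantale) \<longleftrightarrow>
            strictly_faithful TYPE('a) \<and> star_factor TYPE('a)) \<and>
         (strictly_faithful TYPE('a) \<and> star_factor TYPE('a) \<longleftrightarrow>
            (\<exists>P :: 'a set. star_separating P \<and> cyclic P))"
  using star_simple_imp_faithful_factor faithful_factor_imp_cyclic cyclic_imp_star_simple
  by blast

end
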